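(* Let $\varepsilon,q\in Q$ and suppose $L_W$ is an $\varepsilon$-fuzzy Lawvere Laplacian. For a $0$-cochain $\vec x=(x_v)_{v\in V}\in C^0F$, if $$\underline F_{v\triangleleft e}x_v\preceq_{W(v,w)\cdot q}\underline F_{w\triangleleft e}x_w$$ for all edges $e$ and vertices $v,w$ with $v\triangleleft e\triangleright w$ (i.e. $\partial e=\{v,w\}$, both orderings), then $\vec x\in\mathcal S_{\varepsilon\cdot q}(L_W)$.
   Context: Throughout, $\mathsf Q=(Q,\preceq,\cdot,1)$ is a commutative, unital, semicartesian quantale: $(Q,\preceq)$ is a complete lattice, $\cdot$ is an associative commutative operation with unit $1$ that distributes over arbitrary joins in each variable, and $p\cdot q\preceq p\wedge q$ (so $1=\top$). $[p,q]:=\bigvee\{r: p\cdot r\preceq q\}$. A (small) $\mathsf Q$-category $\mathsf C$ is a set $\mathrm{ob}(\mathsf C)$ with elements $\hom_{\mathsf C}(x,y)\in Q$ such that $\hom_{\mathsf C}(x,x)=1$ and $\hom_{\mathsf C}(x,y)\cdot\hom_{\mathsf C}(y,z)\preceq\hom_{\mathsf C}(x,z)$. A $\mathsf Q$-functor is a function $F$ on objects with $\hom_{\mathsf C}(x,y)\preceq\hom_{\mathsf D}(Fx,Fy)$. $x\preceq_q y$ means $\hom(x,y)\succeq q$; $x\approx_q y$ means $x\preceq_q y$ and $y\preceq_q x$. $Q$ itself is a $\mathsf Q$-category with $\hom(p,q)=[p,q]$. Given a set $\mathsf S$, $S:\mathsf S\to\mathrm{ob}(\mathsf C)$ and $W:\mathsf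 S\to Q$, the weighted meet $\bigwedge^W S$ is an object (unique up to $\approx_1$) with $\hom_{\mathsf C}(x,\bigwedge^W S)=\bigwedge_{c\in\mathsf S}[W(c),\hom_{\mathsf C}(x,S(c))]$ for all $x$; weighted joins satisfy $\hom_{\mathsf C}(\bigvee^W S,x)=\bigwedge_{c}[W(c),\hom_{\mathsf C}(S(c),x)]$. A $\mathsf Q$-category is a complete weighted lattice if it has all weighted meets and joins. $\mathsf Q$-functors $F:\mathsf C\to\mathsf D$, $G:\mathsf D\to\mathsf C$ are $q$-adjoint, $F\dashv_q G$, if $\hom_{\mathsf D}(Fx,y)\approx_q\hom_{\mathsf C}(x,Gy)$ (in $Q$) for all $x,y$. $G=(V,E)$ is a simple undirected graph; $\partial e$ is the set of endpoints of $e$; $N_v$ is the set of neighbors of $v$; $v\triangleleft e$ means $v\in\partial e$. $\underline F$ is a network sheaf and $\overline F$ a network cosheaf of complete weighted lattices agreeing on objects: for each $\sigma\in V\sqcup E$ a complete weighted lattice $F\sigma$, and for each $v\triangleleft e$ (arbitrary) $\mathsf Q$-functors $\underline F_{v\triangleleft e}:Fv\to Fe$ and $\overline F_{e\triangleright v}:Fe\to Fv$. $C^0F=\prod_{v\in V}Fv$ with $\hom_{C^0F}(\vec x,\vec y)=\bigwedge_v\hom_{Fv}(x_v,y_v)$. $W:V\times V\to Q$ is a weighting. The Lawvere Laplacian $L_W:\mathrm{ob}(C^0F)\to\mathrm{ob}(C^0F)$ is $$(L_W\vec x)_v=\bigwedge^{W(v,-)}_{w\in N_v,\ \partial e=\{v,w\}}\overline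 F_{e\triangleright v}\underline F_{w\triangleleft e}x_w$$ (with any choice of representatives of the weighted meets). $L_W$ is $\varepsilon$-fuzzy if $\underline F_{v\triangleleft e}\dashv_\varepsilon\overline F_{e\triangleright v}$ for every $v\triangleleft e$. $\mathcal S_q(L_W)$ is the full $\mathsf Q$-subcategory of $C^0F$ on the objects $\vec x$ with $\vec x\preceq_q L_W\vec x$. *)

theory Defs
  imports Main "HOL-Library.FuncSet"
begin

section \<open>Quantales\<close>

text \<open>
  Commutativity makes the distributive law in one variable sufficient. The last axiom is
  equivalent to \<open>1 = top\<close>.
\<close>

class semicartesian_quantale = complete_lattice + comm_monoid_mult +
  assumes mult_Sup_distrib: "p * Sup A = (SUP r\<in>A. p * r)"
    and mult_le_inf: "p * q \<le> inf p q"

definition residual :: "'q::semicartesian_quantale \<Rightarrow> 'q \<Rightarrow> 'q" where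
  "residual p q = Sup {r. p * r \<le> q}"

section \<open>Categories enriched in a quantale\<close>

record ('a, 'q) qcat =
  ob :: "'a set"
  hom :: "'a \<Rightarrow> 'a \<Rightarrow> 'q"

definition qcategory :: "('a, 'q::semicartesian_quantale) qcat \<Rightarrow> bool" where
  "qcategory C \<longleftrightarrow>
     (\<forall>x\<in>ob C. hom C x x = 1) \<and>
     (\<forall>x\<in>ob C. \<forall>y\<in>ob C. \<forall>z\<in>ob C. hom C x y * hom C y z \<le> hom C x z)"

definition qfunctor ::
  "('a, 'q::semicartesian_quantale) qcat \<Rightarrow> ('b, 'q) qcat \<Rightarrow> ('a \<Rightarrow> 'b) \<Rightarrow> bool" where
  "qfunctor C D F \<longleftrightarrow>
     F \<in> ob C \<rightarrow> ob D \<and> (\<forall>x\<in>ob C. \<forall>y\<in>ob C. hom C x y \<le> hom D (F x) (F y))"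

definition qle :: "('a, 'q::semicartesian_quantale) qcat \<Rightarrow> 'q \<Rightarrow> 'a \<Rightarrow> 'a \<Rightarrow> bool" where
  "qle C q x y \<longleftrightarrow> q \<le> hom C x y"

definition qiso :: "('a, 'q::semicartesian_quantale) qcat \<Rightarrow> 'q \<Rightarrow> 'a \<Rightarrow> 'a \<Rightarrow> bool" where
  "qiso C q x y \<longleftrightarrow> qle C q x y \<and> qle C q y x"

definition quantale_qcat :: "('q::semicartesian_quantale, 'q) qcat" where
  "quantale_qcat = \<lparr>ob = UNIV, hom = residual\<rparr>"

definition full_subqcat ::
  "('a, 'q::semicartesian_quantale) qcat \<Rightarrow> 'a set \<Rightarrow> ('a, 'q) qcat" where
  "full_subqcat C A = \<lparr>ob = ob C \<inter> A, hom = hom C\<rparr>"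

definition qadjoint ::
  "'q \<Rightarrow> ('a, 'q::semicartesian_quantale) qcat \<Rightarrow> ('b, 'q) qcat \<Rightarrow>
   ('a \<Rightarrow> 'b) \<Rightarrow> ('b \<Rightarrow> 'a) \<Rightarrow> bool" where
  "qadjoint q C D F G \<longleftrightarrow>
     qfunctor C D F \<and> qfunctor D C G \<and>
     (\<forall>x\<in>ob C. \<forall>y\<in>ob D. qiso quantale_qcat q (hom D (F x) y) (hom C x (G y)))"

section \<open>Weighted meets and joins\<close>

text \<open>
  Weighted meets and joins are unique only up to \<open>qiso C 1\<close>, so they are relations between
  a weighted diagram and an object.
\<close>

definition is_weighted_meet ::
  "('a, 'q::semicartesian_quantale) qcat \<Rightarrow> 'i set \<Rightarrow> ('i \<Rightarrow> 'q) \<Rightarrow> ('i \<Rightarrow> 'a) \<Rightarrow> 'a \<Rightarrow> bool" where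
  "is_weighted_meet C I W S m \<longleftrightarrow>
     m \<in> ob C \<and> (\<forall>x\<in>ob C. hom C x m = (INF c\<in>I. residual (W c) (hom C x (S c))))"

definition is_weighted_join ::
  "('a, 'q::semicartesian_quantale) qcat \<Rightarrow> 'i set \<Rightarrow> ('i \<Rightarrow> 'q) \<Rightarrow> ('i \<Rightarrow> 'a) \<Rightarrow> 'a \<Rightarrow> bool" where
  "is_weighted_join C I W S j \<longleftrightarrow>
     j \<in> ob C \<and> (\<forall>x\<in>ob C. hom C j x = (INF c\<in>I. residual (W c) (hom C (S c) x)))"

text \<open>
  A definition cannot quantify over the type of the indices. The index type \<open>'a \<times> 'q\<close> is
  large enough: the two lemmas below give weighted meets and joins over index sets of every type.
\<close>

definition complete_weighted_lattice :: "('a, 'q::semicartesian_quantale) qcat \<Rightarrow> bool" where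
  "complete_weighted_lattice C \<longleftrightarrow>
     qcategory C \<and>
     (\<forall>(I :: ('a \<times> 'q) set) W. \<forall>S \<in> I \<rightarrow> ob C.
        (\<exists>m. is_weighted_meet C I W S m) \<and> (\<exists>j. is_weighted_join C I W S j))"

lemma complete_weighted_lattice_meet:
  fixes C :: "('a, 'q::semicartesian_quantale) qcat" and I :: "'i set"
  assumes "complete_weighted_lattice C" and "S \<in> I \<rightarrow> ob C"
  shows "\<exists>m. is_weighted_meet C I W S m"
proof -
  let ?J = "(\<lambda>i. (S i, W i)) ` I"
  have "fst \<in> ?J \<rightarrow> ob C" using assms(2) by auto
  then obtain m where "is_weighted_meet C ?J snd fst m"
    using assms(1) unfolding complete_weighted_lattice_def by blast
  then have "is_weighted_meet C I W S m"
    by (simp add: is_weighted_meet_def image_image)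
  then show ?thesis ..
qed

lemma complete_weighted_lattice_join:
  fixes C :: "('a, 'q::semicartesian_quantale) qcat" and I :: "'i set"
  assumes "complete_weighted_lattice C" and "S \<in> I \<rightarrow> ob C"
  shows "\<exists>j. is_weighted_join C I W S j"
proof -
  let ?J = "(\<lambda>i. (S i, W i)) ` I"
  have "fst \<in> ?J \<rightarrow> ob C" using assms(2) by auto
  then obtain j where "is_weighted_join C ?J snd fst j"
    using assms(1) unfolding complete_weighted_lattice_def by blast
  then have "is_weighted_join C I W S j"
    by (simp add: is_weighted_join_def image_image)
  then show ?thesis ..
qed

section \<open>Network sheaves and cosheaves on a simple graph\<close>

text \<open>
  An edge is the set of its two endpoints, so \<open>v \<in> e\<close> is the incidence relation.
\<close>

definition simple_graph :: "'v set \<Rightarrow> 'v set set \<Rightarrow> bool" where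
  "simple_graph V E \<longleftrightarrow> (\<forall>e\<in>E. e \<subseteq> V \<and> card e = 2)"

definition neighbors :: "'v set set \<Rightarrow> 'v \<Rightarrow> 'v set" where
  "neighbors E v = {w. {v, w} \<in> E}"

text \<open>
  The stalks \<open>F\<close> are indexed by the disjoint union \<open>V <+> E\<close>. They share one type of
  elements but may have different carriers. A sheaf and a cosheaf agreeing on objects are given
  by the same \<open>F\<close>.
\<close>

definition network_sheaf ::
  "'v set \<Rightarrow> 'v set set \<Rightarrow> ('v + 'v set \<Rightarrow> ('a, 'q::semicartesian_quantale) qcat) \<Rightarrow>
   ('v \<Rightarrow> 'v set \<Rightarrow> 'a \<Rightarrow> 'a) \<Rightarrow> bool" where
  "network_sheaf V E F Flo \<longleftrightarrow>
     (\<forall>\<sigma>\<in>V <+> E. complete_weighted_lattice (F \<sigma>)) \<and>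
     (\<forall>e\<in>E. \<forall>v\<in>e. qfunctor (F (Inl v)) (F (Inr e)) (Flo v e))"

definition network_cosheaf ::
  "'v set \<Rightarrow> 'v set set \<Rightarrow> ('v + 'v set \<Rightarrow> ('a, 'q::semicartesian_quantale) qcat) \<Rightarrow>
   ('v set \<Rightarrow> 'v \<Rightarrow> 'a \<Rightarrow> 'a) \<Rightarrow> bool" where
  "network_cosheaf V E F Fup \<longleftrightarrow>
     (\<forall>\<sigma>\<in>V <+> E. complete_weighted_lattice (F \<sigma>)) \<and>
     (\<forall>e\<in>E. \<forall>v\<in>e. qfunctor (F (Inr e)) (F (Inl v)) (Fup e v))"

definition cochains0 ::
  "'v set \<Rightarrow> ('v + 'v set \<Rightarrow> ('a, 'q::semicartesian_quantale) qcat) \<Rightarrow> ('v \<Rightarrow> 'a, 'q) qcat" where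
  "cochains0 V F =
     \<lparr>ob = (\<Pi>\<^sub>E v\<in>V. ob (F (Inl v))),
      hom = (\<lambda>x y. INF v\<in>V. hom (F (Inl v)) (x v) (y v))\<rparr>"

section \<open>The Lawvere Laplacian\<close>

text \<open>
  \<open>L\<close> is a Lawvere Laplacian for some choice of representatives of the weighted meets.
\<close>

definition is_lawvere_laplacian ::
  "'v set \<Rightarrow> 'v set set \<Rightarrow> ('v + 'v set \<Rightarrow> ('a, 'q::semicartesian_quantale) qcat) \<Rightarrow>
   ('v \<Rightarrow> 'v set \<Rightarrow> 'a \<Rightarrow> 'a) \<Rightarrow> ('v set \<Rightarrow> 'v \<Rightarrow> 'a \<Rightarrow> 'a) \<Rightarrow> ('v \<Rightarrow> 'v \<Rightarrow> 'q) \<Rightarrow>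
   (('v \<Rightarrow> 'a) \<Rightarrow> ('v \<Rightarrow> 'a)) \<Rightarrow> bool" where
  "is_lawvere_laplacian V E F Flo Fup W L \<longleftrightarrow>
     L \<in> ob (cochains0 V F) \<rightarrow> ob (cochains0 V F) \<and>
     (\<forall>x\<in>ob (cochains0 V F). \<forall>v\<in>V.
        is_weighted_meet (F (Inl v)) (neighbors E v) (W v)
          (\<lambda>w. Fup {v, w} v (Flo w {v, w} (x w))) (L x v))"

definition is_fuzzy_lawvere_laplacian ::
  "'q \<Rightarrow> 'v set \<Rightarrow> 'v set set \<Rightarrow> ('v + 'v set \<Rightarrow> ('a, 'q::semicartesian_quantale) qcat) \<Rightarrow>
   ('v \<Rightarrow> 'v set \<Rightarrow> 'a \<Rightarrow> 'a) \<Rightarrow> ('v set \<Rightarrow> 'v \<Rightarrow> 'a \<Rightarrow> 'a) \<Rightarrow> ('v \<Rightarrow> 'v \<Rightarrow> 'q) \<Rightarrow>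
   (('v \<Rightarrow> 'a) \<Rightarrow> ('v \<Rightarrow> 'a)) \<Rightarrow> bool" where
  "is_fuzzy_lawvere_laplacian \<epsilon> V E F Flo Fup W L \<longleftrightarrow>
     is_lawvere_laplacian V E F Flo Fup W L \<and>
     (\<forall>e\<in>E. \<forall>v\<in>e. qadjoint \<epsilon> (F (Inl v)) (F (Inr e)) (Flo v e) (Fup e v))"

definition suffix_points ::
  "'q \<Rightarrow> ('a, 'q::semicartesian_quantale) qcat \<Rightarrow> ('a \<Rightarrow> 'a) \<Rightarrow> ('a, 'q) qcat" where
  "suffix_points q C L = full_subqcat C {x. qle C q x (L x)}"

end

theory Submission
  imports Defs
begin

text \<open>
  For an edge \<open>e = {v, w}\<close>, the \<open>\<epsilon>\<close>-adjunction turns the bound \<open>W v w * q\<close> on a hom in the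
  edge stalk into the bound \<open>\<epsilon> * (W v w * q)\<close> on the hom from \<open>x v\<close> to the \<open>w\<close>-th term of the
  meet at \<open>v\<close>. Residuating by \<open>W v w\<close> leaves \<open>\<epsilon> * q\<close>, and the hom into a weighted meet is the
  infimum of these residuals.
\<close>

text \<open>The join of \<open>r\<close> and \<open>s\<close> is \<open>s\<close>, so distributivity
  over the two-element join makes \<open>p * s\<close> the join of \<open>p * r\<close> and
  \<open>p * s\<close>.\<close>

lemma quantale_mult_left_mono:
  fixes p r s :: "'q::semicartesian_quantale"
  assumes "r \<le> s"
  shows "p * r \<le> p * s"
proof -
  have "p * s = p * Sup {r, s}"
    using assms by (simp add: sup.absorb2)
  also have "\<dots> = sup (p * r) (p * s)"
    by (simp only: mult_Sup_distrib) simp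
  finally show ?thesis
    by (simp add: sup.order_iff sup_commute)
qed

text \<open>Multiplication by \<open>p\<close> preserves joins, hence has a right adjoint, namely
  \<open>residual p\<close>.\<close>

lemma le_residual_iff:
  fixes p r s :: "'q::semicartesian_quantale"
  shows "r \<le> residual p s \<longleftrightarrow> p * r \<le> s"
proof
  assume "r \<le> residual p s"
  then have "p * r \<le> p * residual p s"
    by (rule quantale_mult_left_mono)
  \<comment> \<open>Distributivity turns the left side into a join of products \<open>p * r\<close>,
    each below \<open>s\<close> by the choice of \<open>r\<close>.\<close>
  also have "\<dots> \<le> s"
    unfolding residual_def mult_Sup_distrib by (auto intro: SUP_least)
  finally show "p * r \<le> s" .
next
  assume "p * r \<le> s"
  then show "r \<le> residual p s"
    unfolding residual_def by (simp add: Sup_upper)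
qed

text \<open>The direction of \<open>qiso\<close> from \<open>hom D (F x) y\<close> to
  \<open>hom C x (G y)\<close> bounds a residual below by \<epsilon>; transposing costs exactly this
  factor.\<close>

lemma qadjoint_transpose:
  assumes "qadjoint \<epsilon> C D F G" and "x \<in> ob C" and "y \<in> ob D"
    and "qle D r (F x) y"
  shows "qle C (\<epsilon> * r) x (G y)"
proof -
  have "\<epsilon> \<le> residual (hom D (F x) y) (hom C x (G y))"
    using assms(1-3) by (simp add: qadjoint_def qiso_def qle_def quantale_qcat_def)
  then have "\<epsilon> * hom D (F x) y \<le> hom C x (G y)"
    by (simp add: le_residual_iff mult.commute)
  moreover have "\<epsilon> * r \<le> \<epsilon> * hom D (F x) y"
    using assms(4) by (simp add: qle_def quantale_mult_left_mono)
  ultimately show ?thesis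
    unfolding qle_def by (rule order_trans[rotated])
qed

text \<open>An element lies below an infimum of residuals iff it lies below each, and each residual
  is then traded for a product with the weight.\<close>

lemma qle_weighted_meet_iff:
  assumes "is_weighted_meet C I W S m" and "x \<in> ob C"
  shows "qle C r x m \<longleftrightarrow> (\<forall>c\<in>I. qle C (W c * r) x (S c))"
  using assms by (simp add: is_weighted_meet_def qle_def le_INF_iff le_residual_iff)

lemma qle_cochains0_iff:
  "qle (cochains0 V F) r x y \<longleftrightarrow> (\<forall>v\<in>V. qle (F (Inl v)) r (x v) (y v))"
  by (simp add: qle_def cochains0_def le_INF_iff)

theorem lemma3p14:
  fixes V :: "'v set" and E :: "'v set set"
    and F :: "'v + 'v set \<Rightarrow> ('a, 'q::semicartesian_quantale) qcat"
    and Flo :: "'v \<Rightarrow> 'v set \<Rightarrow> 'a \<Rightarrow> 'a"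
    and Fup :: "'v set \<Rightarrow> 'v \<Rightarrow> 'a \<Rightarrow> 'a"
    and W :: "'v \<Rightarrow> 'v \<Rightarrow> 'q"
    and L :: "('v \<Rightarrow> 'a) \<Rightarrow> ('v \<Rightarrow> 'a)"
    and \<epsilon> q :: 'q
    and x :: "'v \<Rightarrow> 'a"
  assumes "simple_graph V E"
    and "network_sheaf V E F Flo"
    and "network_cosheaf V E F Fup"
    and "is_fuzzy_lawvere_laplacian \<epsilon> V E F Flo Fup W L"
    and "x \<in> ob (cochains0 V F)"
    and "\<And>e v w. e \<in> E \<Longrightarrow> e = {v, w} \<Longrightarrow>
           qle (F (Inr e)) (W v w * q) (Flo v e (x v)) (Flo w e (x w))"
  shows "x \<in> ob (suffix_points (\<epsilon> * q) (cochains0 V F) L)"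
proof -
  have "qle (F (Inl v)) (\<epsilon> * q) (x v) (L x v)" if "v \<in> V" for v
  proof -
    have meet: "is_weighted_meet (F (Inl v)) (neighbors E v) (W v)
        (\<lambda>w. Fup {v, w} v (Flo w {v, w} (x w))) (L x v)"
      using assms(4,5) \<open>v \<in> V\<close>
      by (simp add: is_fuzzy_lawvere_laplacian_def is_lawvere_laplacian_def)
    have stalk: "x u \<in> ob (F (Inl u))" if "u \<in> V" for u
      using assms(5) that by (auto simp: cochains0_def)
    have "qle (F (Inl v)) (W v w * (\<epsilon> * q)) (x v) (Fup {v, w} v (Flo w {v, w} (x w)))"
      if "w \<in> neighbors E v" for w
    proof -
      have e: "{v, w} \<in> E"
        using that by (simp add: neighbors_def)
      then have "w \<in> V"
        using assms(1) by (auto simp: simple_graph_def)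
      then have "Flo w {v, w} (x w) \<in> ob (F (Inr {v, w}))"
        using assms(2) e stalk by (auto simp: network_sheaf_def qfunctor_def Pi_iff)
      moreover have "qadjoint \<epsilon> (F (Inl v)) (F (Inr {v, w})) (Flo v {v, w}) (Fup {v, w} v)"
        using assms(4) e by (simp add: is_fuzzy_lawvere_laplacian_def)
      ultimately have "qle (F (Inl v)) (\<epsilon> * (W v w * q)) (x v)
          (Fup {v, w} v (Flo w {v, w} (x w)))"
        using stalk[OF \<open>v \<in> V\<close>] assms(6)[OF e refl] by (blast intro: qadjoint_transpose)
      \<comment> \<open>Commutativity moves the weight \<open>W v w\<close> to the front, where the
        criterion for the weighted meet can absorb it.\<close>
      then show ?thesis
        by (simp add: mult.left_commute)
    qed
    then show ?thesis
      using qle_weighted_meet_iff[OF meet stalk[OF \<open>v \<in> V\<close>]] by blast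
  qed
  then show ?thesis
    using assms(5) by (simp add: suffix_points_def full_subqcat_def qle_cochains0_iff)
qed

end
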